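(* Let $-\mathfrak{L}$ be an operator as in the context. Then, for every $x_0\in\mathbb{R}^N$, $$\|\mathbb{G}_{I-\mathfrak{L}}^{x_0}\|_{L^1(\mathbb{R}^N)}=\|\mathbb{G}_{I-\mathfrak{L}}^{0}\|_{L^1(\mathbb{R}^N)}\le1 .$$ Hence the operator $I-\mathfrak{L}$ has an integrable Green function, with $L^1$-norm bounded by a finite constant independent of $x_0$.
   Context: Throughout $N\ge3$. $-\mathfrak{L}$ is a linear, symmetric, nonnegative operator which is densely defined, $\mathfrak m$-accretive and Dirichlet in $L^1(\mathbb{R}^N)$: writing $A=-\mathfrak{L}$ with domain $D(A)\subset L^1(\mathbb{R}^N)$, $D(A)$ is dense in $L^1$; $\|u\|_{L^1}\le\|u+\lambda A[u]\|_{L^1}$ for all $u\in D(A)$, $\lambda>0$; the range of $I+\lambda A$ is $L^1(\mathbb{R}^N)$ for all $\lambda>0$; and if $f\in L^1$, $a\le f\le b$ a.e. ($a,b\in\mathbb{R}$), then $a\le(I+\lambda A)^{-1}f\le b$ a.e. $\mathbb{H}_{-\mathfrak{L}}^{x_0}(x,t)=\mathbb{H}_{-\mathfrak{L}}^{0}(x-x_0,t)\ge0$ is the heat kernel of $-\mathfrak{L}$, i.e. the symmetric convolution kernel of the (contraction, positivity preserving) semigroup on $L^1(\mathbb{R}^N)$ generated by $\mathfrak{L}$. The Green function of $I-\mathfrak{L}$ is the nonnegative function $$\mathbb{G}_{I-\mathfrak{L}}^{x_0}(x)=\int_0^\infty e^{-t}\,\mathbb{H}_{-\mathfrak{L}}^{x_0}(x,t)\,dt,\qquad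 \mathbb{G}_{I-\mathfrak{L}}^{x_0}=\mathbb{G}_{I-\mathfrak{L}}^{0}(\cdot-x_0).$$ *)

theory Defs
  imports "HOL-Analysis.Analysis"
begin

text \<open>
  Elements of \<open>L\<^sup>1\<close> are represented by Borel functions that are integrable with respect to
  Lebesgue measure; equality in \<open>L\<^sup>1\<close> is equality almost everywhere. Operators on \<open>L\<^sup>1\<close> act on
  representatives and are required to respect this equality.
\<close>

definition L1 :: "('a::euclidean_space \<Rightarrow> real) set" where
  "L1 = {f. integrable lborel f}"

definition L1_norm :: "('a::euclidean_space \<Rightarrow> real) \<Rightarrow> real" where
  "L1_norm f = (LINT x|lborel. \<bar>f x\<bar>)"

definition L2 :: "('a::euclidean_space \<Rightarrow> real) set" where
  "L2 = {f \<in> borel_measurable lborel. integrable lborel (\<lambda>x. (f x)\<^sup>2)}"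

definition linear_L1_operator ::
    "('a::euclidean_space \<Rightarrow> real) set \<Rightarrow> (('a \<Rightarrow> real) \<Rightarrow> ('a \<Rightarrow> real)) \<Rightarrow> bool" where
  "linear_L1_operator D A \<longleftrightarrow>
     D \<subseteq> L1 \<and> (\<forall>u\<in>D. A u \<in> L1) \<and>
     (\<forall>u\<in>D. \<forall>v\<in>L1. (AE x in lborel. u x = v x) \<longrightarrow>
        v \<in> D \<and> (AE x in lborel. A u x = A v x)) \<and>
     (\<lambda>x. 0) \<in> D \<and>
     (\<forall>u\<in>D. \<forall>v\<in>D. \<forall>a b. (\<lambda>x. a * u x + b * v x) \<in> D \<and>
        (AE x in lborel. A (\<lambda>x. a * u x + b * v x) x = a * A u x + b * A v x))"

text \<open>
  Symmetry and nonnegativity refer to the \<open>L\<^sup>2\<close> inner product, hence to those \<open>u\<close> in the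
  domain for which both \<open>u\<close> and \<open>A u\<close> are square integrable.
\<close>

definition symmetric_operator ::
    "('a::euclidean_space \<Rightarrow> real) set \<Rightarrow> (('a \<Rightarrow> real) \<Rightarrow> ('a \<Rightarrow> real)) \<Rightarrow> bool" where
  "symmetric_operator D A \<longleftrightarrow>
     (\<forall>u\<in>D \<inter> L2. \<forall>v\<in>D \<inter> L2. A u \<in> L2 \<longrightarrow> A v \<in> L2 \<longrightarrow>
        (LINT x|lborel. A u x * v x) = (LINT x|lborel. u x * A v x))"

definition nonnegative_operator ::
    "('a::euclidean_space \<Rightarrow> real) set \<Rightarrow> (('a \<Rightarrow> real) \<Rightarrow> ('a \<Rightarrow> real)) \<Rightarrow> bool" where
  "nonnegative_operator D A \<longleftrightarrow>
     (\<forall>u\<in>D \<inter> L2. A u \<in> L2 \<longrightarrow> 0 \<le> (LINT x|lborel. A u x * u x))"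

definition L1_dense :: "('a::euclidean_space \<Rightarrow> real) set \<Rightarrow> bool" where
  "L1_dense D \<longleftrightarrow> (\<forall>f\<in>L1. \<forall>\<epsilon>>0. \<exists>u\<in>D. L1_norm (\<lambda>x. f x - u x) < \<epsilon>)"

definition m_accretive_L1 ::
    "('a::euclidean_space \<Rightarrow> real) set \<Rightarrow> (('a \<Rightarrow> real) \<Rightarrow> ('a \<Rightarrow> real)) \<Rightarrow> bool" where
  "m_accretive_L1 D A \<longleftrightarrow>
     (\<forall>u\<in>D. \<forall>r>0. L1_norm u \<le> L1_norm (\<lambda>x. u x + r * A u x)) \<and>
     (\<forall>r>0. \<forall>f\<in>L1. \<exists>u\<in>D. AE x in lborel. u x + r * A u x = f x)"

text \<open>
  The function \<open>u\<close> below is the resolvent of \<open>f\<close>, the unique solution in \<open>D\<close> of \<open>u + r A u = f\<close>.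
\<close>

definition dirichlet_L1 ::
    "('a::euclidean_space \<Rightarrow> real) set \<Rightarrow> (('a \<Rightarrow> real) \<Rightarrow> ('a \<Rightarrow> real)) \<Rightarrow> bool" where
  "dirichlet_L1 D A \<longleftrightarrow>
     (\<forall>r>0. \<forall>f\<in>L1. \<forall>a b. (AE x in lborel. a \<le> f x \<and> f x \<le> b) \<longrightarrow>
        (\<forall>u\<in>D. (AE x in lborel. u x + r * A u x = f x) \<longrightarrow>
           (AE x in lborel. a \<le> u x \<and> u x \<le> b)))"

definition admissible_operator ::
    "('a::euclidean_space \<Rightarrow> real) set \<Rightarrow> (('a \<Rightarrow> real) \<Rightarrow> ('a \<Rightarrow> real)) \<Rightarrow> bool" where
  "admissible_operator D A \<longleftrightarrow>
     linear_L1_operator D A \<and> symmetric_operator D A \<and> nonnegative_operator D A \<and>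
     L1_dense D \<and> m_accretive_L1 D A \<and> dirichlet_L1 D A"

definition C0_semigroup_L1 ::
    "(real \<Rightarrow> ('a::euclidean_space \<Rightarrow> real) \<Rightarrow> ('a \<Rightarrow> real)) \<Rightarrow> bool" where
  "C0_semigroup_L1 T \<longleftrightarrow>
     (\<forall>t\<ge>0. linear_L1_operator L1 (T t) \<and> (\<exists>M. \<forall>f\<in>L1. L1_norm (T t f) \<le> M * L1_norm f)) \<and>
     (\<forall>f\<in>L1. AE x in lborel. T 0 f x = f x) \<and>
     (\<forall>s\<ge>0. \<forall>t\<ge>0. \<forall>f\<in>L1. AE x in lborel. T (s + t) f x = T s (T t f) x) \<and>
     (\<forall>f\<in>L1. \<forall>t\<ge>0. ((\<lambda>s. L1_norm (\<lambda>x. T s f x - T t f x)) \<longlongrightarrow> 0) (at t within {0..}))"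

text \<open>
  \<open>L\<close> with domain \<open>D\<close> is the infinitesimal generator of \<open>T\<close>; the equivalence also fixes the
  domain to be exactly the set of \<open>u\<close> for which the difference quotients converge.
\<close>

definition generates_L1 ::
    "('a::euclidean_space \<Rightarrow> real) set \<Rightarrow> (('a \<Rightarrow> real) \<Rightarrow> ('a \<Rightarrow> real)) \<Rightarrow>
     (real \<Rightarrow> ('a \<Rightarrow> real) \<Rightarrow> ('a \<Rightarrow> real)) \<Rightarrow> bool" where
  "generates_L1 D L T \<longleftrightarrow>
     (\<forall>u\<in>L1. \<forall>g\<in>L1.
        (u \<in> D \<and> (AE x in lborel. L u x = g x)) \<longleftrightarrow>
        ((\<lambda>h. L1_norm (\<lambda>x. (T h u x - u x) / h - g x)) \<longlongrightarrow> 0) (at_right 0))"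

text \<open>
  \<open>H x0 x t\<close> is the heat kernel with pole \<open>x0\<close> of \<open>A\<close>, that is, the kernel of the semigroup
  generated by \<open>- A\<close>. Only times \<open>t > 0\<close> matter. Contractivity and positivity of the
  semigroup are not postulated: they are consequences of accretivity and of \<open>H \<ge> 0\<close>.
  Integrability of \<open>H y x t * f y\<close> in \<open>y\<close> is demanded explicitly because the Bochner integral
  of a nonintegrable function is zero.
\<close>

definition heat_kernel ::
    "('a::euclidean_space \<Rightarrow> real) set \<Rightarrow> (('a \<Rightarrow> real) \<Rightarrow> ('a \<Rightarrow> real)) \<Rightarrow>
     ('a \<Rightarrow> 'a \<Rightarrow> real \<Rightarrow> real) \<Rightarrow> bool" where
  "heat_kernel D A H \<longleftrightarrow>
     (\<lambda>(x, t). H 0 x t) \<in> borel_measurable (lborel \<Otimes>\<^sub>M restrict_space lborel {0<..}) \<and>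
     (\<forall>t>0. \<forall>x0 x. 0 \<le> H x0 x t \<and> H x0 x t = H 0 (x - x0) t \<and> H x0 x t = H x x0 t) \<and>
     (\<exists>T. C0_semigroup_L1 T \<and> generates_L1 D (\<lambda>u x. - A u x) T \<and>
        (\<forall>t>0. \<forall>f\<in>L1. AE x in lborel.
           integrable lborel (\<lambda>y. H y x t * f y) \<and>
           T t f x = (LINT y|lborel. H y x t * f y)))"

text \<open>
  The Green function of \<open>I + A\<close>. It may be infinite at some points (typically at the pole),
  hence the values in \<^typ>\<open>ennreal\<close>.
\<close>

definition green_function ::
    "('a::euclidean_space \<Rightarrow> 'a \<Rightarrow> real \<Rightarrow> real) \<Rightarrow> 'a \<Rightarrow> 'a \<Rightarrow> ennreal" where
  "green_function H x0 x = (\<integral>\<^sup>+ t\<in>{0<..}. ennreal (exp (- t) * H x0 x t) \<partial>lborel)"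

end

theory Submission
  imports Defs
begin

text \<open>
  By translation invariance and Tonelli's theorem,
  \<open>\<parallel>G\<^sup>x\<^sup>0\<parallel> = \<parallel>G\<^sup>0\<parallel> = \<integral>\<^sub>0\<^sup>\<infinity> exp (- t) c(t) dt\<close>, where \<open>c(t)\<close> is the mass of the heat kernel
  \<open>H 0 \<sqdot> t\<close>; hence everything reduces to \<open>c(t) \<le> 1\<close> (\<open>heat_kernel_mass_le_1\<close>). For \<open>f \<ge> 0\<close>
  Tonelli's theorem also gives \<open>\<parallel>T t f\<parallel> = c(t) \<parallel>f\<parallel>\<close>, so \<open>c(t) \<le> 1\<close> follows as soon as the
  semigroup \<open>T\<close> is known to be contractive.

  Contractivity (\<open>accretive_contraction\<close>) is the easy half of the Lumer--Phillips theorem. For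
  \<open>u\<close> in the domain \<open>D\<close> of the generator the orbit \<open>T s u\<close> stays in \<open>D\<close>
  (\<open>generator_commutes\<close>), and accretivity makes the upper right derivative of
  \<open>s \<mapsto> \<parallel>T s u\<parallel>\<close> nonpositive (\<open>accretive_right_derivative\<close>). This function being continuous, it
  is nonincreasing (\<open>nonincreasing_from_right_derivative\<close>), whence \<open>\<parallel>T t u\<parallel> \<le> \<parallel>u\<parallel>\<close>; the general
  case follows by density of \<open>D\<close>.
\<close>

section \<open>The seminorm of integrable functions\<close>

lemma L1_add: "f \<in> L1 \<Longrightarrow> g \<in> L1 \<Longrightarrow> (\<lambda>x. f x + g x) \<in> L1"
  by (simp add: L1_def)

lemma L1_diff: "f \<in> L1 \<Longrightarrow> g \<in> L1 \<Longrightarrow> (\<lambda>x. f x - g x) \<in> L1"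
  by (simp add: L1_def)

lemma L1_cmult: "f \<in> L1 \<Longrightarrow> (\<lambda>x. c * f x) \<in> L1"
  by (simp add: L1_def)

lemma L1_uminus: "f \<in> L1 \<Longrightarrow> (\<lambda>x. - f x) \<in> L1"
  by (simp add: L1_def)

lemma L1_divide: "f \<in> L1 \<Longrightarrow> (\<lambda>x. f x / c) \<in> L1"
  by (simp add: L1_def)

lemmas L1_intros = L1_add L1_diff L1_cmult L1_uminus L1_divide

lemma L1_norm_nonneg: "0 \<le> L1_norm f"
  by (simp add: L1_norm_def)

lemma L1_norm_cong_AE:
  assumes "f \<in> L1" "g \<in> L1" "AE x in lborel. f x = g x"
  shows "L1_norm f = L1_norm g"
  unfolding L1_norm_def using assms
  by (intro integral_cong_AE) (auto simp: L1_def)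

lemma L1_norm_triangle:
  assumes "f \<in> L1" "g \<in> L1"
  shows "L1_norm (\<lambda>x. f x + g x) \<le> L1_norm f + L1_norm g"
proof -
  have "L1_norm (\<lambda>x. f x + g x) \<le> (LINT x|lborel. \<bar>f x\<bar> + \<bar>g x\<bar>)"
    unfolding L1_norm_def using assms
    by (intro integral_mono) (auto simp: L1_def)
  also have "\<dots> = L1_norm f + L1_norm g"
    unfolding L1_norm_def using assms by (subst Bochner_Integration.integral_add) (auto simp: L1_def)
  finally show ?thesis .
qed

lemma L1_norm_cmult: "L1_norm (\<lambda>x. c * f x) = \<bar>c\<bar> * L1_norm f"
  by (simp add: L1_norm_def abs_mult)

lemma L1_norm_minus_commute: "L1_norm (\<lambda>x. f x - g x) = L1_norm (\<lambda>x. g x - f x)"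
  by (simp add: L1_norm_def abs_minus_commute)

lemma L1_norm_reverse_triangle:
  assumes "f \<in> L1" "g \<in> L1"
  shows "\<bar>L1_norm f - L1_norm g\<bar> \<le> L1_norm (\<lambda>x. f x - g x)"
  using L1_norm_triangle[of "\<lambda>x. f x - g x" g] L1_norm_triangle[of "\<lambda>x. g x - f x" f]
    L1_norm_minus_commute[of f g] L1_intros assms
  by fastforce

section \<open>A monotonicity criterion by one-sided derivatives\<close>

text \<open>
  The hypothesis says that the upper right Dini derivative of \<open>\<phi>\<close> is nonpositive at every point.
\<close>

lemma nonincreasing_from_right_derivative:
  fixes \<phi> :: "real \<Rightarrow> real"
  assumes cont: "continuous_on {0..} \<phi>"
    and deriv: "\<And>s e. 0 \<le> s \<Longrightarrow> 0 < e \<Longrightarrow> \<forall>\<^sub>F h in at_right 0. \<phi> (s + h) \<le> \<phi> s + e * h"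
    and t: "0 \<le> t"
  shows "\<phi> t \<le> \<phi> 0"
proof -
  have bound: "\<phi> t \<le> \<phi> 0 + e * t" if e: "0 < e" for e
  proof -
    \<comment> \<open>If the last point where the bound holds were before \<open>t\<close>, the hypothesis at that point would
      extend the bound beyond it.\<close>
    define S where "S = {s \<in> {0..t}. \<phi> s \<le> \<phi> 0 + e * s}"
    have "continuous_on {0..t} \<phi>"
      using cont by (rule continuous_on_subset) auto
    then have "closed S"
      unfolding S_def by (intro continuous_on_closed_Collect_le continuous_intros) auto
    moreover have "bounded S"
      by (rule bounded_subset[of "{0..t}"]) (auto simp: S_def)
    moreover have "0 \<in> S"
      using t by (auto simp: S_def)
    ultimately obtain s where s: "s \<in> S" "\<And>r. r \<in> S \<Longrightarrow> r \<le> s"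
      using compact_attains_sup[of S] by (auto simp: compact_eq_bounded_closed)
    have "s = t"
    proof (rule ccontr)
      assume "s \<noteq> t"
      then have "0 \<le> s" "s < t"
        using s(1) by (auto simp: S_def)
      then have "\<forall>\<^sub>F h in at_right 0. \<phi> (s + h) \<le> \<phi> s + e * h \<and> h < t - s \<and> 0 < h"
        by (intro eventually_conj deriv e eventually_at_rightI[of 0 "t - s"]) auto
      then obtain h where h: "\<phi> (s + h) \<le> \<phi> s + e * h" "h < t - s" "0 < h"
        using eventually_happens[of _ "at_right (0::real)"] by auto
      then have "s + h \<in> S"
        using s(1) by (auto simp: S_def algebra_simps)
      then show False
        using s(2) h(3) by force
    qed
    then show ?thesis
      using s(1) by (auto simp: S_def)
  qed
  show ?thesis
  proof (rule field_le_epsilon)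
    fix d :: real assume "0 < d"
    then have "\<phi> t \<le> \<phi> 0 + (d / (t + 1)) * t"
      using t by (intro bound) auto
    also have "(d / (t + 1)) * t \<le> d"
      using t \<open>0 < d\<close> by (simp add: field_simps)
    finally show "\<phi> t \<le> \<phi> 0 + d" by simp
  qed
qed

section \<open>Contractivity of the semigroup\<close>

lemma C0_semigroup_L1D:
  assumes "C0_semigroup_L1 T"
  shows "0 \<le> t \<Longrightarrow> f \<in> L1 \<Longrightarrow> T t f \<in> L1"
    and "0 \<le> t \<Longrightarrow> f \<in> L1 \<Longrightarrow> g \<in> L1 \<Longrightarrow>
      AE x in lborel. T t (\<lambda>x. a * f x + b * g x) x = a * T t f x + b * T t g x"
    and "0 \<le> t \<Longrightarrow> \<exists>M\<ge>0. \<forall>f\<in>L1. L1_norm (T t f) \<le> M * L1_norm f"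
    and "f \<in> L1 \<Longrightarrow> AE x in lborel. T 0 f x = f x"
    and "0 \<le> s \<Longrightarrow> 0 \<le> t \<Longrightarrow> f \<in> L1 \<Longrightarrow> AE x in lborel. T (s + t) f x = T s (T t f) x"
    and "0 \<le> t \<Longrightarrow> f \<in> L1 \<Longrightarrow>
      ((\<lambda>s. L1_norm (\<lambda>x. T s f x - T t f x)) \<longlongrightarrow> 0) (at t within {0..})"
proof -
  have lin: "linear_L1_operator L1 (T t)"
    and bdd: "\<exists>M. \<forall>f\<in>L1. L1_norm (T t f) \<le> M * L1_norm f" if "0 \<le> t" for t
    using assms that unfolding C0_semigroup_L1_def by blast+
  show "T t f \<in> L1" if "0 \<le> t" "f \<in> L1"
    using lin[OF that(1)] that(2) unfolding linear_L1_operator_def by blast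
  show "AE x in lborel. T t (\<lambda>x. a * f x + b * g x) x = a * T t f x + b * T t g x"
    if "0 \<le> t" "f \<in> L1" "g \<in> L1"
    using lin[OF that(1)] that(2,3) unfolding linear_L1_operator_def by blast
  show "\<exists>M\<ge>0. \<forall>f\<in>L1. L1_norm (T t f) \<le> M * L1_norm f" if t: "0 \<le> t"
  proof -
    obtain M where M: "\<forall>f\<in>L1. L1_norm (T t f) \<le> M * L1_norm f"
      using bdd[OF t] by blast
    have "L1_norm (T t f) \<le> \<bar>M\<bar> * L1_norm f" if "f \<in> L1" for f
    proof -
      have "L1_norm (T t f) \<le> M * L1_norm f" using M that by blast
      also have "\<dots> \<le> \<bar>M\<bar> * L1_norm f"
        by (intro mult_right_mono L1_norm_nonneg) simp
      finally show ?thesis .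
    qed
    then show ?thesis
      by (intro exI[of _ "\<bar>M\<bar>"]) simp
  qed
  show "AE x in lborel. T 0 f x = f x" if "f \<in> L1"
    using assms that unfolding C0_semigroup_L1_def by blast
  show "AE x in lborel. T (s + t) f x = T s (T t f) x" if "0 \<le> s" "0 \<le> t" "f \<in> L1"
    using assms that unfolding C0_semigroup_L1_def by blast
  show "((\<lambda>s. L1_norm (\<lambda>x. T s f x - T t f x)) \<longlongrightarrow> 0) (at t within {0..})"
    if "0 \<le> t" "f \<in> L1"
    using assms that unfolding C0_semigroup_L1_def by blast
qed

text \<open>
  The difference quotients of \<open>T t u\<close> are the images under the bounded operator \<open>T t\<close> of those of
  \<open>u\<close>, hence converge to \<open>T t (L u)\<close>. As the definition of generator fixes the domain to be
  maximal, this gives \<open>T t u \<in> D\<close>.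
\<close>

lemma generator_commutes:
  assumes T: "C0_semigroup_L1 T" and gen: "generates_L1 D L T"
    and u: "u \<in> D" "u \<in> L1" "L u \<in> L1" and t: "0 \<le> t"
  shows "T t u \<in> D" and "AE x in lborel. L (T t u) x = T t (L u) x"
proof -
  note TL1 = C0_semigroup_L1D(1)[OF T]
  obtain M where M: "0 \<le> M" "\<And>f. f \<in> L1 \<Longrightarrow> L1_norm (T t f) \<le> M * L1_norm f"
    using C0_semigroup_L1D(3)[OF T t] by blast
  let ?q = "\<lambda>h x. (T h u x - u x) / h - L u x"
  have lim: "((\<lambda>h. L1_norm (?q h)) \<longlongrightarrow> 0) (at_right 0)"
    using gen u unfolding generates_L1_def by auto
  have "L1_norm (\<lambda>x. (T h (T t u) x - T t u x) / h - T t (L u) x) \<le> M * L1_norm (?q h)"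
    if h: "0 < h" for h
  proof -
    have q: "?q h \<in> L1" "T h u \<in> L1"
      using u h by (auto intro!: L1_intros TL1)
    \<comment> \<open>Linearity is available for combinations of two functions only; the three terms of \<open>?q h\<close>
      are split as \<open>T h u / h - ?w / h\<close>.\<close>
    let ?w = "\<lambda>x. 1 * u x + h * L u x"
    have w: "?w \<in> L1"
      using u by (intro L1_intros) auto
    have 1: "AE x in lborel. T (h + t) u x = T h (T t u) x"
      "AE x in lborel. T (t + h) u x = T t (T h u) x"
      using C0_semigroup_L1D(5)[OF T] h t u by auto
    have 2: "AE x in lborel. T t ?w x = 1 * T t u x + h * T t (L u) x"
      by (intro C0_semigroup_L1D(2)[OF T] t u)
    have 3: "AE x in lborel. T t (\<lambda>x. (1/h) * T h u x + (- (1/h)) * ?w x) x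
        = (1/h) * T t (T h u) x + (- (1/h)) * T t ?w x"
      by (intro C0_semigroup_L1D(2)[OF T] t q w)
    have 4: "(\<lambda>x. (1/h) * T h u x + (- (1/h)) * ?w x) = ?q h"
      using h by (auto simp: field_simps)
    have "AE x in lborel. (T h (T t u) x - T t u x) / h - T t (L u) x = T t (?q h) x"
      using 1 2 3 unfolding 4
    proof eventually_elim
      case (elim x)
      then show ?case using h by (simp add: field_simps)
    qed
    then have "L1_norm (\<lambda>x. (T h (T t u) x - T t u x) / h - T t (L u) x) = L1_norm (T t (?q h))"
      using u h t q by (intro L1_norm_cong_AE L1_intros TL1) auto
    also have "\<dots> \<le> M * L1_norm (?q h)"
      by (rule M(2)[OF q(1)])
    finally show ?thesis .
  qed
  then have "\<forall>\<^sub>F h in at_right 0.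
      L1_norm (\<lambda>x. (T h (T t u) x - T t u x) / h - T t (L u) x) \<le> M * L1_norm (?q h)"
    by (auto simp: eventually_at_filter)
  moreover have "((\<lambda>h. M * L1_norm (?q h)) \<longlongrightarrow> 0) (at_right 0)"
    using tendsto_mult_left[OF lim, of M] by (simp only: mult_zero_right)
  ultimately have "((\<lambda>h. L1_norm (\<lambda>x. (T h (T t u) x - T t u x) / h - T t (L u) x)) \<longlongrightarrow> 0)
      (at_right 0)"
    by (rule tendsto_sandwich[OF always_eventually _ tendsto_const, rotated]) (simp add: L1_norm_nonneg)
  moreover have "T t u \<in> L1" "T t (L u) \<in> L1"
    using u t by (auto intro: TL1)
  ultimately show "T t u \<in> D" "AE x in lborel. L (T t u) x = T t (L u) x"
    using gen unfolding generates_L1_def by blast+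
qed

text \<open>
  Accretivity at \<open>T h v\<close> compares \<open>T h v\<close> with \<open>T h v + h A (T h v)\<close>, which differs from \<open>v\<close>
  by \<open>o(h)\<close>: a backward Euler step. The error divided by \<open>h\<close> is
  \<open>(T h v - v) / h + A v\<close>, which vanishes in the limit by definition of the generator, minus
  \<open>T h (- A v) + A v\<close>, which does by strong continuity.
\<close>

lemma accretive_right_derivative:
  assumes T: "C0_semigroup_L1 T" and gen: "generates_L1 D (\<lambda>u x. - A u x) T"
    and lin: "linear_L1_operator D A" and acc: "m_accretive_L1 D A"
    and v: "v \<in> D" and e: "0 < e"
  shows "\<forall>\<^sub>F h in at_right 0. L1_norm (T h v) \<le> L1_norm v + e * h"
proof -
  note TL1 = C0_semigroup_L1D(1)[OF T]
  have v1: "v \<in> L1" "A v \<in> L1"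
    using lin v by (auto simp: linear_L1_operator_def)
  let ?p = "\<lambda>h x. (T h v x - v x) / h - (- A v x)"
  let ?r = "\<lambda>h x. T h (\<lambda>x. - A v x) x - (- A v x)"
  have nv: "(\<lambda>x. - A v x) \<in> L1"
    by (intro L1_intros v1)
  have "((\<lambda>h. L1_norm (?p h)) \<longlongrightarrow> 0) (at_right 0)"
    using v by (intro gen[unfolded generates_L1_def, rule_format, OF v1(1) nv, THEN iffD1]) simp
  moreover have "((\<lambda>h. L1_norm (?r h)) \<longlongrightarrow> 0) (at_right 0)"
  proof -
    have "((\<lambda>h. L1_norm (\<lambda>x. T h (\<lambda>x. - A v x) x - T 0 (\<lambda>x. - A v x) x)) \<longlongrightarrow> 0) (at_right 0)"
      by (rule tendsto_within_subset[OF C0_semigroup_L1D(6)[OF T order_refl nv]]) auto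
    moreover have "\<forall>\<^sub>F h in at_right 0.
        L1_norm (\<lambda>x. T h (\<lambda>x. - A v x) x - T 0 (\<lambda>x. - A v x) x) = L1_norm (?r h)"
    proof (rule eventually_at_rightI[of 0 1])
      fix h :: real assume "h \<in> {0<..<1}"
      then show "L1_norm (\<lambda>x. T h (\<lambda>x. - A v x) x - T 0 (\<lambda>x. - A v x) x) = L1_norm (?r h)"
        using C0_semigroup_L1D(4)[OF T nv] nv v1
        by (intro L1_norm_cong_AE L1_intros TL1) auto
    qed auto
    ultimately show ?thesis
      using tendsto_cong by fastforce
  qed
  ultimately have "((\<lambda>h. L1_norm (?p h) + L1_norm (?r h)) \<longlongrightarrow> 0) (at_right 0)"
    using tendsto_add by fastforce
  then have "\<forall>\<^sub>F h in at_right 0. L1_norm (?p h) + L1_norm (?r h) < e"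
    by (rule order_tendstoD) (rule e)
  moreover have "\<forall>\<^sub>F h in at_right (0::real). 0 < h"
    by (simp add: eventually_at_filter)
  ultimately show ?thesis
  proof eventually_elim
    case (elim h)
    have Th: "T h v \<in> D" "AE x in lborel. - A (T h v) x = T h (\<lambda>x. - A v x) x"
      using generator_commutes[OF T gen v v1(1) nv, of h] elim by auto
    have L: "T h v \<in> L1" "A (T h v) \<in> L1" "T h (\<lambda>x. - A v x) \<in> L1"
      using lin Th(1) elim nv by (auto simp: linear_L1_operator_def intro: TL1)
    let ?m = "\<lambda>x. (-1) * ?r h x"
    let ?s = "\<lambda>x. h * (?p h x + ?m x)"
    have "AE x in lborel. T h v x + h * A (T h v) x = v x + ?s x"
      using Th(2)
    proof eventually_elim
      case (elim x)
      then have "A (T h v) x = - T h (\<lambda>x. - A v x) x" by simp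
      then show ?case using \<open>0 < h\<close> by (simp add: field_simps)
    qed
    then have eq: "L1_norm (\<lambda>x. T h v x + h * A (T h v) x) = L1_norm (\<lambda>x. v x + ?s x)"
      by (rule L1_norm_cong_AE[rotated 2]) (intro L1_intros L v1)+
    have "L1_norm (T h v) \<le> L1_norm (\<lambda>x. T h v x + h * A (T h v) x)"
      using acc Th(1) elim by (auto simp: m_accretive_L1_def)
    also have "\<dots> \<le> L1_norm v + L1_norm ?s"
      unfolding eq by (rule L1_norm_triangle) (intro L1_intros L v1)+
    also have "L1_norm ?s = h * L1_norm (\<lambda>x. ?p h x + ?m x)"
      using elim by (subst L1_norm_cmult) simp
    also have "L1_norm (\<lambda>x. ?p h x + ?m x) \<le> L1_norm (?p h) + L1_norm ?m"
      by (rule L1_norm_triangle) (intro L1_intros L v1)+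
    also have "L1_norm ?m = L1_norm (?r h)"
      by (subst L1_norm_cmult) simp
    finally have "L1_norm (T h v) \<le> L1_norm v + h * (L1_norm (?p h) + L1_norm (?r h))"
      using elim by (simp add: mult_left_mono)
    also have "\<dots> \<le> L1_norm v + h * e"
      using elim by (intro add_left_mono mult_left_mono) auto
    finally show ?case by (simp add: mult.commute)
  qed
qed

lemma accretive_contraction_on_domain:
  assumes T: "C0_semigroup_L1 T" and gen: "generates_L1 D (\<lambda>u x. - A u x) T"
    and lin: "linear_L1_operator D A" and acc: "m_accretive_L1 D A"
    and u: "u \<in> D" and t: "0 \<le> t"
  shows "L1_norm (T t u) \<le> L1_norm u"
proof -
  note TL1 = C0_semigroup_L1D(1)[OF T]
  have u1: "u \<in> L1" "(\<lambda>x. - A u x) \<in> L1"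
    using lin u by (auto simp: linear_L1_operator_def intro: L1_intros)
  have "continuous_on {0..} (\<lambda>s. L1_norm (T s u))"
    unfolding continuous_on_def
  proof (intro ballI)
    fix s :: real assume s: "s \<in> {0..}"
    show "((\<lambda>s. L1_norm (T s u)) \<longlongrightarrow> L1_norm (T s u)) (at s within {0..})"
    proof (rule Lim_null_comparison[THEN LIM_zero_cancel])
      show "\<forall>\<^sub>F r in at s within {0..}. norm (L1_norm (T r u) - L1_norm (T s u))
          \<le> L1_norm (\<lambda>x. T r u x - T s u x)"
        using s u1 TL1 by (auto simp: eventually_at_filter intro!: always_eventually L1_norm_reverse_triangle)
      show "((\<lambda>r. L1_norm (\<lambda>x. T r u x - T s u x)) \<longlongrightarrow> 0) (at s within {0..})"
        using C0_semigroup_L1D(6)[OF T] s u1 by auto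
    qed
  qed
  moreover have "\<forall>\<^sub>F h in at_right 0. L1_norm (T (s + h) u) \<le> L1_norm (T s u) + e * h"
    if s: "0 \<le> s" and e: "0 < e" for s e
  proof -
    have "T s u \<in> D"
      by (rule generator_commutes(1)[OF T gen u u1 s])
    moreover have "\<forall>\<^sub>F h in at_right (0::real). 0 < h"
      by (simp add: eventually_at_filter)
    ultimately have "\<forall>\<^sub>F h in at_right 0. 0 < h \<and> L1_norm (T h (T s u)) \<le> L1_norm (T s u) + e * h"
      using accretive_right_derivative[OF T gen lin acc _ e] by (auto intro: eventually_conj)
    then show ?thesis
    proof eventually_elim
      case (elim h)
      have "AE x in lborel. T (h + s) u x = T h (T s u) x"
        using C0_semigroup_L1D(5)[OF T] elim s u1 by auto
      then have "L1_norm (T (h + s) u) = L1_norm (T h (T s u))"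
        using elim s u1 by (intro L1_norm_cong_AE TL1) auto
      then show ?case using elim by (simp add: add.commute)
    qed
  qed
  ultimately have "L1_norm (T t u) \<le> L1_norm (T 0 u)"
    using t by (rule nonincreasing_from_right_derivative)
  also have "\<dots> = L1_norm u"
    using C0_semigroup_L1D(4)[OF T u1(1)] u1 by (intro L1_norm_cong_AE TL1) auto
  finally show ?thesis .
qed

lemma accretive_contraction:
  assumes T: "C0_semigroup_L1 T" and gen: "generates_L1 D (\<lambda>u x. - A u x) T"
    and lin: "linear_L1_operator D A" and acc: "m_accretive_L1 D A" and dense: "L1_dense D"
    and f: "f \<in> L1" and t: "0 \<le> t"
  shows "L1_norm (T t f) \<le> L1_norm f"
proof -
  note TL1 = C0_semigroup_L1D(1)[OF T]
  obtain M where M: "0 \<le> M" "\<And>f. f \<in> L1 \<Longrightarrow> L1_norm (T t f) \<le> M * L1_norm f"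
    using C0_semigroup_L1D(3)[OF T t] by blast
  show ?thesis
  proof (rule field_le_epsilon)
    fix e :: real assume e: "0 < e"
    define d where "d = e / (1 + M)"
    have "0 < d" using e M by (simp add: d_def)
    then obtain u where u: "u \<in> D" "L1_norm (\<lambda>x. f x - u x) < d"
      using dense f by (auto simp: L1_dense_def)
    have u1: "u \<in> L1" using lin u by (auto simp: linear_L1_operator_def)
    let ?w = "\<lambda>x. f x - u x"
    have w: "?w \<in> L1" using f u1 by (rule L1_diff)
    have "AE x in lborel. T t (\<lambda>x. 1 * u x + 1 * ?w x) x = 1 * T t u x + 1 * T t ?w x"
      by (intro C0_semigroup_L1D(2)[OF T] t u1 w)
    then have "L1_norm (T t f) = L1_norm (\<lambda>x. T t u x + T t ?w x)"
      using f u1 w t by (intro L1_norm_cong_AE L1_intros TL1) auto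
    also have "\<dots> \<le> L1_norm (T t u) + L1_norm (T t ?w)"
      by (intro L1_norm_triangle TL1 t u1 w)
    also have "\<dots> \<le> L1_norm u + M * L1_norm ?w"
      by (intro add_mono M(2) w accretive_contraction_on_domain[OF T gen lin acc u(1) t])
    also have "L1_norm u \<le> L1_norm f + L1_norm ?w"
      using L1_norm_reverse_triangle[OF f u1] by simp
    also have "L1_norm f + L1_norm ?w + M * L1_norm ?w = L1_norm f + (1 + M) * L1_norm ?w"
      by (simp add: algebra_simps)
    also have "\<dots> \<le> L1_norm f + (1 + M) * d"
      using u(2) M(1) by (intro add_left_mono mult_left_mono) auto
    also have "(1 + M) * d = e" using M(1) by (simp add: d_def)
    finally show "L1_norm (T t f) \<le> L1_norm f + e" by simp
  qed
qed

section \<open>Mass of the heat kernel\<close>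

lemma nn_integral_lborel_translate:
  fixes g :: "'a::euclidean_space \<Rightarrow> ennreal"
  assumes "g \<in> borel_measurable borel"
  shows "(\<integral>\<^sup>+ x. g (x - a) \<partial>lborel) = (\<integral>\<^sup>+ x. g x \<partial>lborel)"
proof -
  have "(\<integral>\<^sup>+ x. g x \<partial>lborel) = (\<integral>\<^sup>+ x. g x \<partial>distr lborel borel ((+) (- a)))"
    by (subst lborel_distr_plus) simp
  also have "\<dots> = (\<integral>\<^sup>+ x. g (x - a) \<partial>lborel)"
    using assms by (subst nn_integral_distr) auto
  finally show ?thesis by simp
qed

text \<open>Measurability in \<open>x\<close> at a fixed time holds at every \<open>t > 0\<close>, being that of a section.\<close>

lemma heat_kernel_measurable:
  assumes "heat_kernel D A H"
  shows "(\<lambda>(x, t). H 0 x t) \<in> borel_measurable (lborel \<Otimes>\<^sub>M restrict_space lborel {0<..})"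
    and "0 < t \<Longrightarrow> (\<lambda>x. H 0 x t) \<in> borel_measurable borel"
proof -
  show *: "(\<lambda>(x, t). H 0 x t) \<in> borel_measurable (lborel \<Otimes>\<^sub>M restrict_space lborel {0<..})"
    using assms by (simp add: heat_kernel_def)
  assume "0 < t"
  then have "(\<lambda>x. (x, t)) \<in> lborel \<rightarrow>\<^sub>M lborel \<Otimes>\<^sub>M restrict_space lborel {0<..}"
    by (intro measurable_Pair measurable_ident_sets measurable_const) (auto simp: space_restrict_space)
  from measurable_compose[OF this *] show "(\<lambda>x. H 0 x t) \<in> borel_measurable borel"
    by simp
qed

text \<open>
  The semigroup multiplies the integral of a nonnegative function by the mass of the kernel; the
  test function used is the indicator of the unit cube.
\<close>

lemma heat_kernel_mass_le_1:
  assumes adm: "admissible_operator D A" and hk: "heat_kernel D A H" and t: "0 < t"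
  shows "(\<integral>\<^sup>+ x. ennreal (H 0 x t) \<partial>lborel) \<le> 1"
proof -
  let ?c = "\<integral>\<^sup>+ x. ennreal (H 0 x t) \<partial>lborel"
  obtain T where T: "C0_semigroup_L1 T" and gen: "generates_L1 D (\<lambda>u x. - A u x) T"
    and ker: "\<And>f. f \<in> L1 \<Longrightarrow> AE x in lborel.
           integrable lborel (\<lambda>y. H y x t * f y) \<and> T t f x = (LINT y|lborel. H y x t * f y)"
    using hk t unfolding heat_kernel_def by blast
  have H: "0 \<le> H y x t" "H y x t = H 0 (x - y) t" for x y
    using hk t unfolding heat_kernel_def by blast+
  note [measurable] = heat_kernel_measurable(2)[OF hk t]
  define f where "f = (indicator (cbox 0 One) :: 'a \<Rightarrow> real)"
  have [measurable]: "f \<in> borel_measurable borel" by (simp add: f_def)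
  have f0: "0 \<le> f y" for y by (simp add: f_def)
  have fnn: "(\<integral>\<^sup>+ y. ennreal (f y) \<partial>lborel) = 1"
    by (simp add: f_def ennreal_indicator emeasure_lborel_cbox_eq)
  have f: "f \<in> L1"
    unfolding L1_def mem_Collect_eq
    by (rule integrableI_nonneg) (auto simp: f0 fnn)
  have Tf: "T t f \<in> L1" using C0_semigroup_L1D(1)[OF T] t f by simp
  have norm: "ennreal (L1_norm g) = (\<integral>\<^sup>+ x. ennreal \<bar>g x\<bar> \<partial>lborel)" if "g \<in> L1" for g :: "'a \<Rightarrow> real"
    using that unfolding L1_norm_def L1_def
    by (subst nn_integral_eq_integral) auto
  have "?c = (\<integral>\<^sup>+ y. ennreal (f y) * ?c \<partial>lborel)"
    by (simp add: nn_integral_multc fnn)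
  also have "\<dots> = (\<integral>\<^sup>+ y. ennreal (f y) * (\<integral>\<^sup>+ x. ennreal (H 0 (x - y) t) \<partial>lborel) \<partial>lborel)"
    by (subst nn_integral_lborel_translate[of "\<lambda>x. ennreal (H 0 x t)"]) auto
  also have "\<dots> = (\<integral>\<^sup>+ y. (\<integral>\<^sup>+ x. ennreal (f y) * ennreal (H 0 (x - y) t) \<partial>lborel) \<partial>lborel)"
    by (subst nn_integral_cmult) auto
  also have "\<dots> = (\<integral>\<^sup>+ x. (\<integral>\<^sup>+ y. ennreal (f y) * ennreal (H 0 (x - y) t) \<partial>lborel) \<partial>lborel)"
    by (rule lborel_pair.Fubini') measurable
  also have "\<dots> = (\<integral>\<^sup>+ x. ennreal \<bar>T t f x\<bar> \<partial>lborel)"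
  proof (rule nn_integral_cong_AE)
    show "AE x in lborel. (\<integral>\<^sup>+ y. ennreal (f y) * ennreal (H 0 (x - y) t) \<partial>lborel) = ennreal \<bar>T t f x\<bar>"
      using ker[OF f]
    proof eventually_elim
      case (elim x)
      have "(\<integral>\<^sup>+ y. ennreal (f y) * ennreal (H 0 (x - y) t) \<partial>lborel)
          = (\<integral>\<^sup>+ y. ennreal (H y x t * f y) \<partial>lborel)"
        by (intro nn_integral_cong) (metis H f0 ennreal_mult mult.commute)
      also have "\<dots> = ennreal (LINT y|lborel. H y x t * f y)"
        using elim H(1) f0 by (intro nn_integral_eq_integral) auto
      also have "\<dots> = ennreal \<bar>T t f x\<bar>"
        using elim H(1) f0 by (auto simp: integral_nonneg_AE)
      finally show ?case .
    qed
  qed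
  also have "\<dots> = ennreal (L1_norm (T t f))"
    by (rule norm[OF Tf, symmetric])
  also have "\<dots> \<le> ennreal (L1_norm f)"
    using adm t f accretive_contraction[OF T gen]
    by (intro ennreal_leI) (auto simp: admissible_operator_def)
  also have "\<dots> = 1"
    using norm[OF f] f0 fnn by simp
  finally show ?thesis .
qed

section \<open>The Green function\<close>

lemma nn_integral_exp_minus: "(\<integral>\<^sup>+ t\<in>{0<..}. ennreal (exp (- t)) \<partial>lborel) = 1"
proof -
  have "(\<integral>\<^sup>+ t\<in>{0<..}. ennreal (exp (- t)) \<partial>lborel) = (\<integral>\<^sup>+ t. ennreal (exp (- t)) * indicator {0..} t \<partial>lborel)"
    using AE_lborel_singleton[of "0::real"]
    by (intro nn_integral_cong_AE) (auto simp: indicator_def elim!: eventually_mono)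
  also have "\<dots> = ennreal (0 - (- exp (- 0)))"
  proof (rule nn_integral_FTC_atLeast)
    show "((\<lambda>t::real. - exp (- t)) \<longlongrightarrow> 0) at_top"
      by (rule tendsto_eq_intros filterlim_compose[OF exp_at_bot] filterlim_uminus_at_bot_at_top | simp)+
  qed (auto intro!: derivative_eq_intros)
  finally show ?thesis by simp
qed

lemma sigma_finite_half_line: "sigma_finite_measure (restrict_space lborel {0::real<..})"
  by (intro sigma_finite_measure_restrict_space sigma_finite_lborel) auto

context
  fixes D :: "('a::euclidean_space \<Rightarrow> real) set" and A and H
  assumes hk: "heat_kernel D A H"
begin

lemma green_function_translate: "green_function H x0 x = green_function H 0 (x - x0)"
proof -
  have "H x0 x t = H 0 (x - x0) t" if "0 < t" for t
    using hk that unfolding heat_kernel_def by blast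
  then show ?thesis
    unfolding green_function_def by (intro nn_integral_cong) (auto simp: indicator_def)
qed

text \<open>
  The kernel is jointly measurable on the half space \<open>t > 0\<close> only, so the time integral is taken
  with respect to Lebesgue measure restricted to the half line.
\<close>

lemma green_integrand_measurable:
  "(\<lambda>(x, t). ennreal (exp (- t) * H 0 x t))
    \<in> borel_measurable (lborel \<Otimes>\<^sub>M restrict_space lborel {0<..})"
proof -
  note [measurable] = heat_kernel_measurable(1)[OF hk]
  have [measurable]: "(\<lambda>t::real. exp (- t)) \<in> borel_measurable (restrict_space lborel {0<..})"
    by (intro measurable_restrict_space1) simp
  have "(\<lambda>p. ennreal (exp (- snd p) * (\<lambda>(x, t). H 0 x t) p))
      \<in> borel_measurable (lborel \<Otimes>\<^sub>M restrict_space lborel {0<..})"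
    by measurable
  then show ?thesis by (simp add: case_prod_beta')
qed

lemma green_function_eq_half_line:
  "green_function H 0 x = (\<integral>\<^sup>+ t. ennreal (exp (- t) * H 0 x t) \<partial>restrict_space lborel {0<..})"
  unfolding green_function_def by (subst nn_integral_restrict_space) auto

lemma green_function_measurable: "green_function H x0 \<in> borel_measurable borel"
proof -
  interpret half: sigma_finite_measure "restrict_space lborel {0::real<..}"
    by (rule sigma_finite_half_line)
  have [measurable]: "green_function H 0 \<in> borel_measurable borel"
    using half.borel_measurable_nn_integral[OF green_integrand_measurable]
    by (simp add: green_function_eq_half_line[abs_def])
  have "(\<lambda>x. green_function H 0 (x - x0)) \<in> borel_measurable borel"
    by measurable
  then show ?thesis by (simp add: green_function_translate[of x0, abs_def])
qed

lemma green_function_mass: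
  "(\<integral>\<^sup>+ x. green_function H x0 x \<partial>lborel) = (\<integral>\<^sup>+ x. green_function H 0 x \<partial>lborel)"
  unfolding green_function_translate[of x0]
  by (rule nn_integral_lborel_translate) (rule green_function_measurable)

lemma green_function_mass_le_1:
  assumes adm: "admissible_operator D A"
  shows "(\<integral>\<^sup>+ x. green_function H x0 x \<partial>lborel) \<le> 1"
proof -
  interpret half: sigma_finite_measure "restrict_space lborel {0::real<..}"
    by (rule sigma_finite_half_line)
  interpret pair_sigma_finite "lborel :: 'a measure" "restrict_space lborel {0::real<..}" ..
  have "(\<integral>\<^sup>+ x. green_function H x0 x \<partial>lborel)
      = (\<integral>\<^sup>+ x. (\<integral>\<^sup>+ t. ennreal (exp (- t) * H 0 x t) \<partial>restrict_space lborel {0<..}) \<partial>lborel)"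
    unfolding green_function_mass[of x0] green_function_eq_half_line ..
  also have "\<dots> = (\<integral>\<^sup>+ t. (\<integral>\<^sup>+ x. ennreal (exp (- t) * H 0 x t) \<partial>lborel) \<partial>restrict_space lborel {0<..})"
    by (rule Fubini'[symmetric]) (rule green_integrand_measurable)
  also have "\<dots> \<le> (\<integral>\<^sup>+ t. ennreal (exp (- t)) \<partial>restrict_space lborel {0::real<..})"
  proof (rule nn_integral_mono)
    fix t :: real assume "t \<in> space (restrict_space lborel {0<..})"
    then have t: "0 < t" by (simp add: space_restrict_space)
    note [measurable] = heat_kernel_measurable(2)[OF hk t]
    have "(\<integral>\<^sup>+ x. ennreal (exp (- t) * H 0 x t) \<partial>lborel)
        = ennreal (exp (- t)) * (\<integral>\<^sup>+ x. ennreal (H 0 x t) \<partial>lborel)"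
      by (simp add: ennreal_mult' nn_integral_cmult)
    also have "\<dots> \<le> ennreal (exp (- t)) * 1"
      by (intro mult_left_mono heat_kernel_mass_le_1[OF adm hk t]) simp
    finally show "(\<integral>\<^sup>+ x. ennreal (exp (- t) * H 0 x t) \<partial>lborel) \<le> ennreal (exp (- t))"
      by simp
  qed
  also have "\<dots> = 1"
    using nn_integral_exp_minus by (subst nn_integral_restrict_space) auto
  finally show ?thesis .
qed

end

text \<open>
  A nonnegative extended function of finite integral is finite almost everywhere, so its real part,
  which is zero where the function is infinite, represents the same element of \<open>L\<^sup>1\<close>.
\<close>

lemma L1_norm_enn2real_le:
  fixes g :: "'a::euclidean_space \<Rightarrow> ennreal"
  assumes [measurable]: "g \<in> borel_measurable borel"
    and le: "(\<integral>\<^sup>+ x. g x \<partial>lborel) \<le> ennreal C" and C: "0 \<le> C"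
  shows "AE x in lborel. g x < \<infinity>"
    and "(\<lambda>x. enn2real (g x)) \<in> L1"
    and "L1_norm (\<lambda>x. enn2real (g x)) \<le> C"
proof -
  have "(\<integral>\<^sup>+ x. g x \<partial>lborel) \<noteq> \<infinity>"
    using le by (auto simp: top_unique)
  then have "AE x in lborel. g x \<noteq> \<infinity>"
    by (intro nn_integral_PInf_AE) auto
  then show AE: "AE x in lborel. g x < \<infinity>"
    by (simp add: top.not_eq_extremum)
  have eq: "(\<integral>\<^sup>+ x. ennreal (enn2real (g x)) \<partial>lborel) = (\<integral>\<^sup>+ x. g x \<partial>lborel)"
    using AE by (intro nn_integral_cong_AE) (auto elim!: eventually_mono)
  show L1: "(\<lambda>x. enn2real (g x)) \<in> L1"
    unfolding L1_def mem_Collect_eq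
    using le by (intro integrableI_nonneg) (auto simp: eq intro: le_less_trans)
  have "ennreal (L1_norm (\<lambda>x. enn2real (g x))) = (\<integral>\<^sup>+ x. g x \<partial>lborel)"
    using L1 nn_integral_eq_integral[of lborel "\<lambda>x. enn2real (g x)"]
    by (simp add: L1_norm_def L1_def eq)
  then show "L1_norm (\<lambda>x. enn2real (g x)) \<le> C"
    using le C by (metis ennreal_le_iff)
qed

theorem lemma7p16:
  fixes D :: "(real ^ 'n \<Rightarrow> real) set"
    and A :: "(real ^ 'n \<Rightarrow> real) \<Rightarrow> (real ^ 'n \<Rightarrow> real)"
    and H :: "real ^ 'n \<Rightarrow> real ^ 'n \<Rightarrow> real \<Rightarrow> real"
  assumes "CARD('n) \<ge> 3"
    and "admissible_operator D A"
    and "heat_kernel D A H"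
  shows "(\<forall>x0. green_function H x0 \<in> borel_measurable lborel \<and>
            (\<integral>\<^sup>+ x. green_function H x0 x \<partial>lborel) = (\<integral>\<^sup>+ x. green_function H 0 x \<partial>lborel) \<and>
            (\<integral>\<^sup>+ x. green_function H 0 x \<partial>lborel) \<le> 1) \<and>
         (\<exists>C::real. \<forall>x0.
            (AE x in lborel. green_function H x0 x < \<infinity>) \<and>
            (\<lambda>x. enn2real (green_function H x0 x)) \<in> L1 \<and>
            L1_norm (\<lambda>x. enn2real (green_function H x0 x)) \<le> C)"
proof (intro conjI exI[of _ 1] allI)
  fix x0 :: "real ^ 'n"
  note meas = green_function_measurable[OF assms(3), of x0]
  have le: "(\<integral>\<^sup>+ x. green_function H x0 x \<partial>lborel) \<le> ennreal 1"
    using green_function_mass_le_1[OF assms(3,2)] by simp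
  show "green_function H x0 \<in> borel_measurable lborel"
    using meas by simp
  show "(\<integral>\<^sup>+ x. green_function H x0 x \<partial>lborel) = (\<integral>\<^sup>+ x. green_function H 0 x \<partial>lborel)"
    by (rule green_function_mass[OF assms(3)])
  show "(\<integral>\<^sup>+ x. green_function H 0 x \<partial>lborel) \<le> 1"
    by (rule green_function_mass_le_1[OF assms(3,2)])
  show "AE x in lborel. green_function H x0 x < \<infinity>"
    and "(\<lambda>x. enn2real (green_function H x0 x)) \<in> L1"
    and "L1_norm (\<lambda>x. enn2real (green_function H x0 x)) \<le> 1"
    using L1_norm_enn2real_le[OF meas le] by simp_all
qed

end
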